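(* There exists an absolute constant $C' > 0$ (independent of $n$ and $k$) such that for all integers $n \ge k \ge 3$, $$\Delta_k(n) \ge C'\,\frac{\log(k)}{\log(n)}.$$
   Context: For distinct points $A,B,C \in \mathbb{R}^2$, $\angle ABC \in [0^\circ,180^\circ]$ denotes the (unsigned) angle at $B$ between the vectors $\vec{BA}$ and $\vec{BC}$, measured in degrees (collinear triples give $0^\circ$ or $180^\circ$). For integers $n \ge k \ge 3$, define $$\Gamma_k(n) = \sup\{\gamma : \forall\, S \subset \mathbb{R}^2 \text{ with } |S|=n,\ \exists\, T \subseteq S \text{ with } |T|=k \text{ such that } |\angle ABC-90^\circ| \ge \gamma \text{ for all distinct } A,B,C \in T\},$$ and $\Delta_k(n) := 90^\circ - \Gamma_k(n)$. *)

theory Defs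
  imports "HOL-Analysis.Analysis"
begin

text \<open>The unsigned angle at \<open>B\<close> in degrees; meaningful only for \<open>A \<noteq> B\<close> and \<open>C \<noteq> B\<close>.\<close>

definition angle_deg :: "real ^ 2 \<Rightarrow> real ^ 2 \<Rightarrow> real ^ 2 \<Rightarrow> real" where
  "angle_deg A B C =
     arccos (((A - B) \<bullet> (C - B)) / (norm (A - B) * norm (C - B))) * 180 / pi"

text \<open>\<open>card S = n\<close> forces \<open>S\<close> to be finite only for \<open>n > 0\<close>. For \<open>3 \<le> k \<le> n\<close> the set
  below contains \<open>0\<close> and is bounded above by \<open>90\<close>, so the supremum over the reals is the
  true one; outside this range \<open>Gamma\<close> carries no meaning.\<close>

definition Gamma :: "nat \<Rightarrow> nat \<Rightarrow> real" where
  "Gamma k n = Sup {\<gamma>::real. \<forall>S::(real ^ 2) set. card S = n \<longrightarrow>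
     (\<exists>T\<subseteq>S. card T = k \<and>
       (\<forall>A\<in>T. \<forall>B\<in>T. \<forall>C\<in>T. A \<noteq> B \<longrightarrow> B \<noteq> C \<longrightarrow> A \<noteq> C \<longrightarrow>
          \<bar>angle_deg A B C - 90\<bar> \<ge> \<gamma>))}"

definition Delta :: "nat \<Rightarrow> nat \<Rightarrow> real" where
  "Delta k n = 90 - Gamma k n"

end

theory Submission
  imports Defs
begin

text \<open>
  Put \<open>b = k - 1\<close> and choose \<open>m\<close> minimal up to a constant with \<open>b ^ m \<ge> n\<close>. Take \<open>m\<close> unit
  vectors whose directions are spaced by \<open>\<pi> / m\<close>, and form the sums of \<open>\<epsilon> ^ i * a\<^sub>i * u\<^sub>i\<close> with
  digits \<open>a\<^sub>i < b\<close>: a \<open>b\<close>-ary tree of depth \<open>m\<close> in which two points branching at level \<open>i\<close>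
  differ by nearly a multiple of \<open>u\<^sub>i\<close>. Among \<open>b + 1\<close> points, some three branch at two
  different levels, so they span an angle close to one between distinct directions,
  which stays away from \<open>0\<close> and \<open>\<pi>\<close> by at least \<open>\<pi> / (2 * m)\<close>.
\<close>

section \<open>Approximate directions and the tree of shrunken copies\<close>

text \<open>The scalar \<open>s\<close> may be negative, so \<open>u\<close> stands for an
  unoriented line. The error is measured relative to \<open>\<bar>s\<bar>\<close>, which makes the
  notion invariant under scaling: shrinking a point set by any factor keeps all its approximate
  directions.\<close>

definition near_dir :: "real \<Rightarrow> 'a::real_normed_vector \<Rightarrow> 'a \<Rightarrow> bool" where
  "near_dir \<eta> u x \<longleftrightarrow> (\<exists>s. s \<noteq> 0 \<and> norm (x - s *\<^sub>R u) \<le> \<eta> * \<bar>s\<bar>)"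

lemma near_dir_scaleR:
  assumes "near_dir \<eta> u x" and "c \<noteq> 0"
  shows "near_dir \<eta> u (c *\<^sub>R x)"
proof -
  obtain s where s: "s \<noteq> 0" "norm (x - s *\<^sub>R u) \<le> \<eta> * \<bar>s\<bar>"
    using assms(1) unfolding near_dir_def by blast
  have "c *\<^sub>R x - (c * s) *\<^sub>R u = c *\<^sub>R (x - s *\<^sub>R u)"
    by (simp add: algebra_simps)
  then have "norm (c *\<^sub>R x - (c * s) *\<^sub>R u) = \<bar>c\<bar> * norm (x - s *\<^sub>R u)"
    by simp
  also have "\<dots> \<le> \<bar>c\<bar> * (\<eta> * \<bar>s\<bar>)"
    using s(2) by (intro mult_left_mono) auto
  finally show ?thesis
    unfolding near_dir_def using s(1) assms(2)
    by (intro exI[of _ "c * s"]) (simp add: abs_mult mult_ac)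
qed

lemma card_pigeonhole:
  assumes "finite B" and "f ` T \<subseteq> B" and "card B < card T"
  obtains x y where "x \<in> T" "y \<in> T" "x \<noteq> y" "f x = f y"
proof -
  have "\<not> inj_on f T"
    using assms card_inj_on_le[of f T B] by linarith
  then show ?thesis
    using that unfolding inj_on_def by blast
qed

text \<open>The invariant of the induction over tree levels. The threshold \<open>b\<close> is the
  number of branches at a node: \<open>b + 1\<close> points are what the pigeonhole principle needs
  to put two into one branch.\<close>

definition spread_triples :: "real \<Rightarrow> nat \<Rightarrow> 'a::real_normed_vector set \<Rightarrow> 'a set \<Rightarrow> bool" where
  "spread_triples \<eta> b D S \<longleftrightarrow>
     (\<forall>T\<subseteq>S. b < card T \<longrightarrow>
        (\<exists>A\<in>T. \<exists>B\<in>T. \<exists>C\<in>T. A \<noteq> B \<and> B \<noteq> C \<and> A \<noteq> C \<and>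
          (\<exists>u\<in>D. \<exists>v\<in>D. u \<noteq> v \<and> near_dir \<eta> u (A - B) \<and> near_dir \<eta> v (C - B))))"

text \<open>Adds a new root level: \<open>b\<close> shrunken copies of \<open>S\<close> are placed
  at the multiples \<open>0, ..., b - 1\<close> of \<open>u\<close>. Points of different copies
  differ nearly along \<open>u\<close>; within a copy the directions of \<open>S\<close> persist.
  The assumption on pairs serves the case of two points in one copy and a third in another.\<close>

lemma ex_spread_triples_step:
  fixes u :: "'a::real_normed_vector"
  assumes fin: "finite S" and u: "u \<noteq> 0" "u \<notin> D" and \<eta>: "\<eta> > 0"
    and pair: "\<And>x y. x \<in> S \<Longrightarrow> y \<in> S \<Longrightarrow> x \<noteq> y \<Longrightarrow> \<exists>v\<in>D. near_dir \<eta> v (x - y)"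
    and spread: "spread_triples \<eta> b D S"
  shows "\<exists>S'. finite S' \<and> card S' = b * card S \<and>
    (\<forall>x\<in>S'. \<forall>y\<in>S'. x \<noteq> y \<longrightarrow> (\<exists>v\<in>insert u D. near_dir \<eta> v (x - y))) \<and>
    spread_triples \<eta> b (insert u D) S'"
proof -
  obtain M where M: "M > 0" "\<And>x. x \<in> S \<Longrightarrow> norm x \<le> M"
    using finite_imp_bounded[OF fin] unfolding bounded_pos by blast
  \<comment> \<open>\<open>2 * M\<close> bounds the diameter of \<open>S\<close>. A shrunken copy
    then has diameter at most \<open>\<eta>\<close>, so differences across copies stay close to
    \<open>u\<close>, and less than \<open>norm u\<close>, so the copies are disjoint; halving
    \<open>norm u\<close> makes the latter strict.\<close>
  define \<epsilon> where "\<epsilon> = min \<eta> (norm u / 2) / (2 * M)"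
  have \<epsilon>: "\<epsilon> > 0" "2 * \<epsilon> * M \<le> \<eta>" "2 * \<epsilon> * M < norm u"
    using M(1) \<eta> u(1) by (auto simp: \<epsilon>_def min_def)
  define f where "f = (\<lambda>(a, x). real a *\<^sub>R u + \<epsilon> *\<^sub>R x)"
  have f_diff: "f (a, x) - f (c, y) = (real a - real c) *\<^sub>R u + \<epsilon> *\<^sub>R (x - y)" for a c x y
    by (simp add: f_def algebra_simps)
  have small: "norm (\<epsilon> *\<^sub>R (x - y)) \<le> 2 * \<epsilon> * M" if "x \<in> S" "y \<in> S" for x y
  proof -
    have "norm (x - y) \<le> 2 * M"
      using norm_triangle_ineq4[of x y] M(2)[OF that(1)] M(2)[OF that(2)] by linarith
    then show ?thesis
      using \<epsilon>(1) by (simp add: mult.left_commute)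
  qed
  have gap: "1 \<le> \<bar>real a - real c\<bar>" if "a \<noteq> c" for a c
    using that by linarith
  have near_u: "near_dir \<eta> u (f (a, x) - f (c, y))"
    if "a \<noteq> c" "x \<in> S" "y \<in> S" for a c x y
  proof -
    have "norm (\<epsilon> *\<^sub>R (x - y)) \<le> \<eta> * 1"
      using small[OF that(2,3)] \<epsilon>(2) by simp
    also have "\<dots> \<le> \<eta> * \<bar>real a - real c\<bar>"
      using gap[OF that(1)] \<eta> by (intro mult_left_mono) auto
    finally show ?thesis
      unfolding near_dir_def f_diff using that(1)
      by (intro exI[of _ "real a - real c"]) simp
  qed
  have copies_disjoint: "f (a, x) \<noteq> f (c, y)" if "a \<noteq> c" "x \<in> S" "y \<in> S" for a c x y
  proof
    assume "f (a, x) = f (c, y)"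
    then have "(real a - real c) *\<^sub>R u = - (\<epsilon> *\<^sub>R (x - y))"
      using f_diff[of a x c y] by (simp add: eq_neg_iff_add_eq_0)
    then have "\<bar>real a - real c\<bar> * norm u = norm (\<epsilon> *\<^sub>R (x - y))"
      by (metis norm_minus_cancel norm_scaleR)
    moreover have "1 * norm u \<le> \<bar>real a - real c\<bar> * norm u"
      using gap[OF that(1)] by (intro mult_right_mono) auto
    ultimately show False
      using small[OF that(2,3)] \<epsilon>(3) by linarith
  qed
  have same_copy: "f (a, x) - f (a, y) = \<epsilon> *\<^sub>R (x - y)" for a x y
    using f_diff[of a x a y] by simp
  have inj: "inj_on f ({..<b} \<times> S)"
  proof (rule inj_onI, clarify)
    fix a x c y assume "x \<in> S" "y \<in> S" "f (a, x) = f (c, y)"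
    moreover from this have "a = c"
      using copies_disjoint by blast
    ultimately show "a = c \<and> x = y"
      using same_copy[of a x y] \<epsilon>(1) by simp
  qed
  define S' where "S' = f ` ({..<b} \<times> S)"
  have "finite S'"
    using fin by (simp add: S'_def)
  moreover have "card S' = b * card S"
    using card_image[OF inj] by (simp add: S'_def card_cartesian_product)
  moreover have "\<exists>v\<in>insert u D. near_dir \<eta> v (p - q)"
    if p: "p \<in> S'" and q: "q \<in> S'" and neq: "p \<noteq> q" for p q
  proof -
    obtain a x c y where pq: "p = f (a, x)" "q = f (c, y)" "x \<in> S" "y \<in> S"
      using p q unfolding S'_def by blast
    show ?thesis
    proof (cases "a = c")
      case True
      with neq pq have "x \<noteq> y" by auto
      then obtain v where "v \<in> D" "near_dir \<eta> v (x - y)"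
        using pair pq by blast
      then show ?thesis
        using near_dir_scaleR[of \<eta> v "x - y" \<epsilon>] \<epsilon>(1) same_copy True pq by auto
    qed (use near_u pq in blast)
  qed
  moreover have "spread_triples \<eta> b (insert u D) S'"
    unfolding spread_triples_def
  proof (intro allI impI)
    fix T assume T: "T \<subseteq> S'" "b < card T"
    \<comment> \<open>Pulling \<open>T\<close> back along the injective \<open>f\<close> exposes the
      digit of each point as a first component, ready for counting.\<close>
    define R where "R = {p \<in> {..<b} \<times> S. f p \<in> T}"
    have T_eq: "T = f ` R"
      using T(1) by (auto simp: R_def S'_def)
    have inj_R: "inj_on f R"
      by (rule inj_on_subset[OF inj]) (auto simp: R_def)
    have card_R: "card R = card T"
      using card_image[OF inj_R] T_eq by simp
    obtain p q where pq: "p \<in> R" "q \<in> R" "p \<noteq> q" "fst p = fst q"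
      by (rule card_pigeonhole[of "{..<b}" fst R]) (use card_R T(2) in \<open>auto simp: R_def\<close>)
    obtain a y z where yz: "p = (a, y)" "q = (a, z)" "y \<noteq> z" "y \<in> S" "z \<in> S"
      using pq by (cases p; cases q) (auto simp: R_def)
    show "\<exists>A\<in>T. \<exists>B\<in>T. \<exists>C\<in>T. A \<noteq> B \<and> B \<noteq> C \<and> A \<noteq> C \<and>
      (\<exists>v\<in>insert u D. \<exists>w\<in>insert u D. v \<noteq> w \<and> near_dir \<eta> v (A - B) \<and> near_dir \<eta> w (C - B))"
    proof (cases "\<exists>r\<in>R. fst r \<noteq> a")
      \<comment> \<open>\<open>T\<close> meets two copies. The apex is \<open>f p\<close>: its
        partner \<open>f q\<close> in the same copy supplies a direction of \<open>D\<close>, the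
        point of the other copy supplies \<open>u\<close>, and these differ since
        \<open>u \<notin> D\<close>.\<close>
      case True
      then obtain c x where cx: "(c, x) \<in> R" "c \<noteq> a" "x \<in> S"
        by (auto simp: R_def)
      obtain v where v: "v \<in> D" "near_dir \<eta> v (z - y)"
        using pair[of z y] yz by blast
      have "near_dir \<eta> v (f q - f p)"
        using near_dir_scaleR[OF v(2), of \<epsilon>] \<epsilon>(1) same_copy yz by simp
      moreover have "near_dir \<eta> u (f (c, x) - f p)"
        using near_u cx yz by blast
      moreover have "f (c, x) \<noteq> f p" "f (c, x) \<noteq> f q"
        using copies_disjoint cx yz by blast+
      moreover have "f p \<noteq> f q"
        using inj_R pq unfolding inj_on_def by blast
      moreover have "f (c, x) \<in> T" "f p \<in> T" "f q \<in> T"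
        using T_eq cx pq by auto
      moreover have "u \<noteq> v"
        using u(2) v(1) by blast
      ultimately show ?thesis
        using v(1) by blast
    next
      \<comment> \<open>\<open>T\<close> lies in the single copy \<open>a\<close>, so dropping the
        digit loses no points and the invariant for \<open>S\<close> yields the triple.\<close>
      case False
      have inj_snd: "inj_on snd R"
        using False by (intro inj_onI prod_eqI) simp_all
      have "snd ` R \<subseteq> S" "b < card (snd ` R)"
        using card_image[OF inj_snd] card_R T(2) by (auto simp: R_def)
      then obtain A B C v w where ABC: "A \<in> snd ` R" "B \<in> snd ` R" "C \<in> snd ` R"
          "A \<noteq> B" "B \<noteq> C" "A \<noteq> C" "v \<in> D" "w \<in> D" "v \<noteq> w"
          "near_dir \<eta> v (A - B)" "near_dir \<eta> w (C - B)"
        using spread unfolding spread_triples_def by meson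
      have "(a, A) \<in> R" "(a, B) \<in> R" "(a, C) \<in> R"
        using ABC(1-3) False by force+
      then have "f (a, A) \<in> T" "f (a, B) \<in> T" "f (a, C) \<in> T"
        using T_eq by auto
      moreover have "f (a, x) = f (a, y) \<longleftrightarrow> x = y" for x y
        using same_copy[of a x y] \<epsilon>(1) by auto
      moreover have "near_dir \<eta> v (f (a, A) - f (a, B))" "near_dir \<eta> w (f (a, C) - f (a, B))"
        using near_dir_scaleR[of \<eta> _ _ \<epsilon>] ABC(10,11) \<epsilon>(1) same_copy by auto
      ultimately show ?thesis
        using ABC(4-9) by blast
    qed
  qed
  ultimately show ?thesis by blast
qed

text \<open>Induction on \<open>D\<close> spends one level on each direction, so the depth is
  \<open>card D\<close>. The clause on pairs is carried along because the step consumes it.\<close>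

lemma ex_spread_triples:
  fixes D :: "'a::real_normed_vector set"
  assumes "finite D" and "0 \<notin> D" and "\<eta> > 0" and "b \<ge> 1"
  shows "\<exists>S. finite S \<and> card S = b ^ card D \<and>
    (\<forall>x\<in>S. \<forall>y\<in>S. x \<noteq> y \<longrightarrow> (\<exists>v\<in>D. near_dir \<eta> v (x - y))) \<and> spread_triples \<eta> b D S"
  using assms(1,2)
proof (induction D rule: finite_induct)
  case empty
  \<comment> \<open>The tree of depth 0 is one point; as \<open>b \<ge> 1\<close>, no subset exceeds
    the threshold and the invariant holds vacuously.\<close>
  have "\<not> b < card T" if "T \<subseteq> {0}" for T :: "'a set"
    using that \<open>b \<ge> 1\<close> card_mono[of "{0}" T] by simp
  then show ?case
    by (intro exI[of _ "{0}"]) (simp add: spread_triples_def)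
next
  case (insert u D)
  then obtain S where S: "finite S" "card S = b ^ card D"
    "\<forall>x\<in>S. \<forall>y\<in>S. x \<noteq> y \<longrightarrow> (\<exists>v\<in>D. near_dir \<eta> v (x - y))" "spread_triples \<eta> b D S"
    by auto
  have "u \<noteq> 0" using insert.prems by auto
  show ?case
    using ex_spread_triples_step[OF S(1) \<open>u \<noteq> 0\<close> insert.hyps(2) \<open>\<eta> > 0\<close> _ S(4)] S(2,3) insert.hyps
    by simp
qed

section \<open>From approximate directions to angles\<close>

text \<open>Write \<open>x = s *\<^sub>R (u + p)\<close> and \<open>y = t *\<^sub>R (v + q)\<close>
  with \<open>p\<close>, \<open>q\<close> of norm at most \<open>\<eta>\<close>. In the quotient
  \<open>s\<close> and \<open>t\<close> cancel up to sign; the error terms add at most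
  \<open>2 * \<eta> + \<eta>\<^sup>2\<close> to the numerator, and each norm is at least
  \<open>1 - \<eta>\<close>.\<close>

lemma near_dir_cos_le:
  fixes u v :: "'a::real_inner"
  assumes x: "near_dir \<eta> u x" and y: "near_dir \<eta> v y"
    and unit: "norm u = 1" "norm v = 1" and c: "\<bar>u \<bullet> v\<bar> \<le> c" and \<eta>: "0 \<le> \<eta>" "\<eta> < 1"
  shows "\<bar>(x \<bullet> y) / (norm x * norm y)\<bar> \<le> (c + 2 * \<eta> + \<eta>\<^sup>2) / (1 - \<eta>)\<^sup>2"
proof -
  have decomp: "\<exists>s r. s \<noteq> 0 \<and> z = s *\<^sub>R (w + r) \<and> norm r \<le> \<eta>"
    if "near_dir \<eta> w z" for w z :: 'a
  proof -
    obtain s where s: "s \<noteq> 0" "norm (z - s *\<^sub>R w) \<le> \<eta> * \<bar>s\<bar>"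
      using \<open>near_dir \<eta> w z\<close> unfolding near_dir_def by blast
    then have "z = s *\<^sub>R (w + inverse s *\<^sub>R (z - s *\<^sub>R w))"
      by (simp add: algebra_simps)
    moreover have "norm (inverse s *\<^sub>R (z - s *\<^sub>R w)) \<le> \<eta>"
      using s unfolding norm_scaleR by (simp add: field_simps)
    ultimately show ?thesis using s(1) by blast
  qed
  obtain s p where s: "s \<noteq> 0" "x = s *\<^sub>R (u + p)" "norm p \<le> \<eta>"
    using decomp[OF x] by blast
  obtain t q where t: "t \<noteq> 0" "y = t *\<^sub>R (v + q)" "norm q \<le> \<eta>"
    using decomp[OF y] by blast
  have "\<bar>u \<bullet> q\<bar> \<le> \<eta>" "\<bar>p \<bullet> v\<bar> \<le> \<eta>"
    using Cauchy_Schwarz_ineq2[of u q] Cauchy_Schwarz_ineq2[of p v] s(3) t(3) unit by simp_all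
  moreover have "\<bar>p \<bullet> q\<bar> \<le> \<eta> * \<eta>"
    using Cauchy_Schwarz_ineq2[of p q] mult_mono[OF s(3) t(3)] \<eta>(1) by simp
  moreover have "(u + p) \<bullet> (v + q) = u \<bullet> v + u \<bullet> q + p \<bullet> v + p \<bullet> q"
    by (simp add: inner_add_left inner_add_right)
  ultimately have num: "\<bar>(u + p) \<bullet> (v + q)\<bar> \<le> c + 2 * \<eta> + \<eta>\<^sup>2"
    using c by (simp add: power2_eq_square)
  have "1 - \<eta> \<le> norm (u + p)" "1 - \<eta> \<le> norm (v + q)"
    using norm_diff_ineq[of u p] norm_diff_ineq[of v q] s(3) t(3) unit by linarith+
  then have den: "(1 - \<eta>)\<^sup>2 \<le> norm (u + p) * norm (v + q)"
    using \<eta>(2) by (simp add: power2_eq_square mult_mono)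
  have "\<bar>(x \<bullet> y) / (norm x * norm y)\<bar> = \<bar>(u + p) \<bullet> (v + q)\<bar> / (norm (u + p) * norm (v + q))"
    using s(1,2) t(1,2) by (simp add: abs_mult)
  also have "\<dots> \<le> (c + 2 * \<eta> + \<eta>\<^sup>2) / (1 - \<eta>)\<^sup>2"
    using num den \<eta> by (intro frac_le) auto
  finally show ?thesis .
qed

text \<open>The quotient is continuous at \<open>\<eta> = 0\<close>, where its value is
  \<open>c < d\<close>.\<close>

lemma ex_small_cos_bound:
  fixes c d :: real
  assumes "c < d"
  shows "\<exists>\<eta>. 0 < \<eta> \<and> \<eta> < 1 \<and> (c + 2 * \<eta> + \<eta>\<^sup>2) / (1 - \<eta>)\<^sup>2 \<le> d"
proof -
  have "((\<lambda>\<eta>. (c + 2 * \<eta> + \<eta>\<^sup>2) / (1 - \<eta>)\<^sup>2) \<longlongrightarrow> (c + 2 * 0 + 0\<^sup>2) / (1 - 0)\<^sup>2) (at_right 0)"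
    by (intro tendsto_intros) auto
  then have "\<forall>\<^sub>F \<eta> in at_right 0. (c + 2 * \<eta> + \<eta>\<^sup>2) / (1 - \<eta>)\<^sup>2 < d"
    using assms by (intro order_tendstoD(2)) auto
  moreover have "\<forall>\<^sub>F \<eta> in at_right (0::real). \<eta> \<in> {0<..<1}"
    by (rule eventually_at_right_real) simp
  ultimately have "\<forall>\<^sub>F \<eta> in at_right 0. 0 < \<eta> \<and> \<eta> < 1 \<and> (c + 2 * \<eta> + \<eta>\<^sup>2) / (1 - \<eta>)\<^sup>2 \<le> d"
    by eventually_elim auto
  then show ?thesis
    using eventually_happens[of _ "at_right (0::real)"] by fastforce
qed

text \<open>The angles \<open>i * pi / m\<close> with \<open>i < m\<close> fill only a half turn,
  since opposite vectors span the same line. Two of them differ by at least \<open>pi / m\<close>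
  and at most \<open>pi - pi / m\<close>; the upper limit gives the bound on negative
  cosines.\<close>

lemma ex_spaced_directions:
  assumes "m \<ge> 2"
  shows "\<exists>D::(real ^ 2) set. finite D \<and> card D = m \<and> (\<forall>u\<in>D. norm u = 1) \<and>
    (\<forall>u\<in>D. \<forall>v\<in>D. u \<noteq> v \<longrightarrow> \<bar>u \<bullet> v\<bar> \<le> cos (pi / real m))"
proof -
  define e :: "nat \<Rightarrow> real ^ 2" where
    "e i = vector [cos (real i * (pi / real m)), sin (real i * (pi / real m))]" for i
  have inner_e: "e i \<bullet> e j = cos ((real i - real j) * (pi / real m))" for i j
    unfolding left_diff_distrib cos_diff by (simp add: e_def inner_vec_def sum_2)
  have norm_e: "norm (e i) = 1" for i
    by (simp add: norm_eq_sqrt_inner inner_e)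
  have lt: "\<bar>e i \<bullet> e j\<bar> \<le> cos (pi / real m)" if "j < i" "i < m" for i j
  proof -
    define t where "t = (real i - real j) * (pi / real m)"
    have "1 \<le> real i - real j" "real i - real j \<le> real m - 1"
      using that by linarith+
    then have "1 * (pi / real m) \<le> t" "t \<le> (real m - 1) * (pi / real m)"
      unfolding t_def by (intro mult_right_mono; simp)+
    then have t: "pi / real m \<le> t" "t \<le> pi - pi / real m"
      using assms by (simp_all add: field_simps)
    have "0 \<le> pi / real m"
      by simp
    then have "cos t \<le> cos (pi / real m)" "cos (pi - pi / real m) \<le> cos t"
      using t by (intro cos_monotone_0_pi_le; linarith)+
    then show ?thesis
      unfolding inner_e t_def[symmetric] by (simp add: abs_le_iff)
  qed
  have spaced: "\<bar>e i \<bullet> e j\<bar> \<le> cos (pi / real m)" if "i \<noteq> j" "i < m" "j < m" for i j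
    using lt[of i j] lt[of j i] that by (cases "i < j") (auto simp: inner_commute)
  \<comment> \<open>Equal unit vectors would have inner product 1, above the spacing bound; hence
    the \<open>m\<close> directions are distinct.\<close>
  have "cos (pi / real m) < cos 0"
    using assms by (intro cos_monotone_0_pi) (auto simp: field_simps)
  moreover have "e i \<bullet> e i = 1" for i
    by (simp add: inner_e)
  ultimately have "e i \<noteq> e j" if "i \<noteq> j" "i < m" "j < m" for i j
    using spaced[OF that] by force
  then have "inj_on e {..<m}"
    by (auto simp: inj_on_def)
  then have "card (e ` {..<m}) = m"
    by (simp add: card_image)
  then show ?thesis
    using norm_e by (intro exI[of _ "e ` {..<m}"]) (auto intro!: spaced)
qed

text \<open>As \<open>arccos\<close> is decreasing, the angle lies between \<open>\<theta>\<close>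
  and \<open>pi - \<theta>\<close>, an interval centred at the right angle.\<close>

lemma angle_deg_le_of_cos_le:
  assumes "\<bar>((A - B) \<bullet> (C - B)) / (norm (A - B) * norm (C - B))\<bar> \<le> cos \<theta>"
    and "0 \<le> \<theta>" "\<theta> \<le> pi"
  shows "\<bar>angle_deg A B C - 90\<bar> \<le> 90 - \<theta> * 180 / pi"
proof -
  define q where "q = ((A - B) \<bullet> (C - B)) / (norm (A - B) * norm (C - B))"
  have q: "q \<le> cos \<theta>" "- cos \<theta> \<le> q"
    using assms(1) unfolding q_def by linarith+
  have cos1: "cos \<theta> \<le> 1" by simp
  have "arccos (cos \<theta>) \<le> arccos q"
    using q cos1 by (intro arccos_le_arccos) linarith+
  moreover have "arccos q \<le> arccos (- cos \<theta>)"
    using q cos1 by (intro arccos_le_arccos) linarith+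
  ultimately have "\<theta> \<le> arccos q" "arccos q \<le> pi - \<theta>"
    using assms(2,3) by (simp_all add: arccos_cos arccos_minus)
  then have "\<theta> * 180 / pi \<le> angle_deg A B C" "angle_deg A B C \<le> (pi - \<theta>) * 180 / pi"
    unfolding angle_deg_def q_def[symmetric] by (intro divide_right_mono mult_right_mono; simp)+
  moreover have "(pi - \<theta>) * 180 / pi = 180 - \<theta> * 180 / pi"
    by (simp add: field_simps)
  ultimately show ?thesis by (simp add: abs_le_iff)
qed

section \<open>Extremal point sets and the bound on \<open>Delta\<close>\<close>

lemma ex_set_without_flat_subset:
  assumes k: "2 \<le> k" and m: "2 \<le> m" and n: "n \<le> (k - 1) ^ m"
  shows "\<exists>S::(real ^ 2) set. card S = n \<and>
    (\<forall>T\<subseteq>S. card T = k \<longrightarrow>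
      (\<exists>A\<in>T. \<exists>B\<in>T. \<exists>C\<in>T. A \<noteq> B \<and> B \<noteq> C \<and> A \<noteq> C \<and>
        \<bar>angle_deg A B C - 90\<bar> \<le> 90 - 90 / real m))"
proof -
  obtain D :: "(real ^ 2) set" where D: "finite D" "card D = m" "\<And>u. u \<in> D \<Longrightarrow> norm u = 1"
    "\<And>u v. u \<in> D \<Longrightarrow> v \<in> D \<Longrightarrow> u \<noteq> v \<Longrightarrow> \<bar>u \<bullet> v\<bar> \<le> cos (pi / real m)"
    using ex_spaced_directions[OF m] by blast
  \<comment> \<open>Half the spacing of the directions: the gap between \<open>cos (pi / m)\<close>
    and \<open>cos \<theta>\<close> absorbs the perturbation \<open>\<eta>\<close>. In degrees
    \<open>\<theta>\<close> is \<open>90 / m\<close>.\<close>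
  define \<theta> where "\<theta> = pi / (2 * real m)"
  have \<theta>: "0 \<le> \<theta>" "\<theta> \<le> pi" "\<theta> < pi / real m" "pi / real m \<le> pi"
    using m by (auto simp: \<theta>_def field_simps)
  have "cos (pi / real m) < cos \<theta>"
    using \<theta> by (intro cos_monotone_0_pi) auto
  then obtain \<eta> where \<eta>: "0 < \<eta>" "\<eta> < 1"
    "(cos (pi / real m) + 2 * \<eta> + \<eta>\<^sup>2) / (1 - \<eta>)\<^sup>2 \<le> cos \<theta>"
    using ex_small_cos_bound by blast
  have "0 \<notin> D" "1 \<le> k - 1"
    using D(3) k by force+
  then obtain S where S: "finite S" "card S = (k - 1) ^ m" "spread_triples \<eta> (k - 1) D S"
    using ex_spread_triples[of D \<eta> "k - 1"] D(1,2) \<eta>(1) by blast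
  \<comment> \<open>Having a spread triple in every large subset passes to subsets of
    \<open>S\<close>, so the tree can be trimmed to exactly \<open>n\<close> points.\<close>
  obtain S' where S': "S' \<subseteq> S" "card S' = n"
    using obtain_subset_with_card_n[of n S] n S(2) by auto
  have "\<exists>A\<in>T. \<exists>B\<in>T. \<exists>C\<in>T. A \<noteq> B \<and> B \<noteq> C \<and> A \<noteq> C \<and>
      \<bar>angle_deg A B C - 90\<bar> \<le> 90 - 90 / real m" if T: "T \<subseteq> S'" "card T = k" for T
  proof -
    have "T \<subseteq> S" "k - 1 < card T"
      using T S'(1) k by auto
    then obtain A B C u v where ABC: "A \<in> T" "B \<in> T" "C \<in> T" "A \<noteq> B" "B \<noteq> C" "A \<noteq> C"
        "u \<in> D" "v \<in> D" "u \<noteq> v" "near_dir \<eta> u (A - B)" "near_dir \<eta> v (C - B)"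
      using S(3) unfolding spread_triples_def by meson
    have "\<bar>((A - B) \<bullet> (C - B)) / (norm (A - B) * norm (C - B))\<bar> \<le> cos \<theta>"
      using near_dir_cos_le[OF ABC(10,11) D(3)[OF ABC(7)] D(3)[OF ABC(8)] D(4)[OF ABC(7-9)]] \<eta>
      by linarith
    then have "\<bar>angle_deg A B C - 90\<bar> \<le> 90 - \<theta> * 180 / pi"
      using \<theta> by (intro angle_deg_le_of_cos_le)
    also have "\<theta> * 180 / pi = 90 / real m"
      using m by (simp add: \<theta>_def field_simps)
    finally show ?thesis using ABC by blast
  qed
  then show ?thesis using S'(2) by blast
qed

lemma Delta_ge:
  assumes k: "3 \<le> k" "k \<le> n" and m: "2 \<le> m" "n \<le> (k - 1) ^ m"
  shows "Delta k n \<ge> 90 / real m"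
proof -
  obtain S :: "(real ^ 2) set" where S: "card S = n"
    "\<And>T. T \<subseteq> S \<Longrightarrow> card T = k \<Longrightarrow>
      \<exists>A\<in>T. \<exists>B\<in>T. \<exists>C\<in>T. A \<noteq> B \<and> B \<noteq> C \<and> A \<noteq> C \<and>
        \<bar>angle_deg A B C - 90\<bar> \<le> 90 - 90 / real m"
    using ex_set_without_flat_subset[of k m n] k m by auto
  define good where "good \<gamma> T \<longleftrightarrow> card T = k \<and>
    (\<forall>A\<in>T. \<forall>B\<in>T. \<forall>C\<in>T. A \<noteq> B \<longrightarrow> B \<noteq> C \<longrightarrow> A \<noteq> C \<longrightarrow>
       \<bar>angle_deg A B C - 90\<bar> \<ge> \<gamma>)" for \<gamma> T
  \<comment> \<open>The value 0 is always admissible, so the set under the supremum is nonempty, as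
    \<open>cSup_least\<close> requires.\<close>
  have "\<exists>T\<subseteq>R. good 0 T" if R: "card R = n" for R
  proof -
    obtain T where "T \<subseteq> R" "card T = k"
      using R k(2) obtain_subset_with_card_n[of k R] by blast
    then show ?thesis
      by (intro exI[of _ T]) (simp add: good_def)
  qed
  moreover have "\<gamma> \<le> 90 - 90 / real m" if \<gamma>: "\<forall>R. card R = n \<longrightarrow> (\<exists>T\<subseteq>R. good \<gamma> T)" for \<gamma>
  proof -
    obtain T where T: "T \<subseteq> S" "good \<gamma> T"
      using \<gamma> S(1) by blast
    then obtain A B C where "A \<in> T" "B \<in> T" "C \<in> T" "A \<noteq> B" "B \<noteq> C" "A \<noteq> C"
        "\<bar>angle_deg A B C - 90\<bar> \<le> 90 - 90 / real m"
      using S(2)[of T] unfolding good_def by blast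
    moreover from this(1-6) have "\<gamma> \<le> \<bar>angle_deg A B C - 90\<bar>"
      using T(2) unfolding good_def by blast
    ultimately show ?thesis by linarith
  qed
  ultimately have "Sup {\<gamma>. \<forall>R. card R = n \<longrightarrow> (\<exists>T\<subseteq>R. good \<gamma> T)} \<le> 90 - 90 / real m"
    by (intro cSup_least) auto
  then have "Gamma k n \<le> 90 - 90 / real m"
    unfolding Gamma_def good_def .
  then show ?thesis by (simp add: Delta_def)
qed

section \<open>Choice of the depth and the final constant\<close>

text \<open>The depth is \<open>ln n / ln (k - 1)\<close> rounded up. Rounding costs a factor 2, and
  replacing \<open>ln (k - 1)\<close> by \<open>ln k\<close> another factor 2.\<close>

lemma ex_exponent:
  assumes "3 \<le> k" "k \<le> n"
  shows "\<exists>m. 2 \<le> m \<and> n \<le> (k - 1) ^ m \<and> real m \<le> 4 * (ln (real n) / ln (real k))"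
proof -
  define b where "b = k - 1"
  have b: "2 \<le> b" "b < n" "k = b + 1" "0 < ln (real b)"
    using assms by (auto simp: b_def)
  define m where "m = nat \<lceil>ln (real n) / ln (real b)\<rceil>"
  \<comment> \<open>Strictness comes from \<open>k - 1 < n\<close>. It forces
    \<open>m \<ge> 2\<close> and lets the 1 lost in rounding be absorbed by doubling the
    ratio.\<close>
  have ratio: "1 < ln (real n) / ln (real b)"
    using b by simp
  then have m: "ln (real n) / ln (real b) \<le> real m" "real m \<le> ln (real n) / ln (real b) + 1"
    unfolding m_def by linarith+
  have "ln (real n) \<le> real m * ln (real b)"
    using m(1) b(4) by (simp add: field_simps)
  also have "\<dots> = ln (real (b ^ m))"
    using b(1) by (simp add: ln_realpow)
  finally have "n \<le> b ^ m"
    using b by simp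
  moreover have "2 \<le> m"
    using m(1) ratio by linarith
  moreover have "real m \<le> 4 * (ln (real n) / ln (real k))"
  proof -
    \<comment> \<open>From \<open>b \<ge> 2\<close>:
      \<open>b + 1 \<le> 2 * b \<le> b * b\<close>.\<close>
    have "k \<le> b\<^sup>2"
      using b(1,3) mult_le_mono1[of 2 b b] unfolding power2_eq_square by linarith
    then have "ln (real k) \<le> ln (real (b\<^sup>2))"
      using assms(1) b(1) by (subst ln_le_cancel_iff) auto
    also have "\<dots> = 2 * ln (real b)"
      using b(1) by (simp add: ln_realpow)
    finally have "2 * ln (real n) / (2 * ln (real b)) \<le> 2 * ln (real n) / ln (real k)"
      using assms b by (intro divide_left_mono) auto
    then show ?thesis
      using m(2) ratio by simp
  qed
  ultimately show ?thesis
    unfolding b_def by blast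
qed

theorem proposition3p2:
  shows "\<exists>C'::real. C' > 0 \<and>
    (\<forall>n k::nat. 3 \<le> k \<longrightarrow> k \<le> n \<longrightarrow> Delta k n \<ge> C' * (ln (real k) / ln (real n)))"
proof (intro exI[of _ "45 / 2"] conjI allI impI)
  fix n k :: nat
  assume kn: "3 \<le> k" "k \<le> n"
  obtain m where m: "2 \<le> m" "n \<le> (k - 1) ^ m" "real m \<le> 4 * (ln (real n) / ln (real k))"
    using ex_exponent[OF kn] by blast
  have "0 < ln (real n) / ln (real k)"
    using kn by simp
  then have "0 < 4 * (ln (real n) / ln (real k)) * real m"
    using m(1) by (intro mult_pos_pos) auto
  \<comment> \<open>The constant \<open>45 / 2\<close> is \<open>90 / 4\<close>: the bound
    \<open>90 / m\<close> meets the factor 4 in the estimate of \<open>m\<close>.\<close>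
  then have "90 / (4 * (ln (real n) / ln (real k))) \<le> 90 / real m"
    using m(3) by (intro divide_left_mono) auto
  moreover have "45 / 2 * (ln (real k) / ln (real n)) = 90 / (4 * (ln (real n) / ln (real k)))"
    by simp
  ultimately show "Delta k n \<ge> 45 / 2 * (ln (real k) / ln (real n))"
    using Delta_ge[OF kn m(1,2)] by linarith
qed simp

end
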